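(* There are an infinite number of homotopy classes of Gauss words.
   Context: An alphabet is a finite set, whose elements are called letters. A word on an alphabet $\mathcal{A}$ is a finite (possibly empty) sequence of letters of $\mathcal{A}$. A Gauss word on $\mathcal{A}$ is a word in which every letter of $\mathcal{A}$ appears exactly twice (so $\mathcal{A}$ is the set of letters appearing in the word). Gauss words $u$ on $\mathcal{A}$ and $v$ on $\mathcal{B}$ are isomorphic if there is a bijection $f:\mathcal{A}\to\mathcal{B}$ such that $f$ applied letterwise to $u$ gives $v$. The homotopy moves on Gauss words are the following (each may be applied in either direction), where $A,B,C$ are individual (distinct) letters and $t,x,y,z$ are arbitrary, possibly empty, sequences of letters such that both sides are Gauss words: Shift: $AxAy \leftrightarrow xAyA$; H1: $xAAy \leftrightarrow xy$; H2: $xAByBAz \leftrightarrow xyz$; H3: $xAByACzBCt \leftrightarrow xBAyCAzCBt$. Two Gauss words are homotopic if one can be transformed into the other by a finite sequence of isomorphisms and homotopy moves. This is an equivalence relation on Gauss words, and its equivalence classes are called homotopy classes. *)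

theory Defs
  imports Main
begin

definition gauss_word_on :: "'a set \<Rightarrow> 'a list \<Rightarrow> bool" where
  "gauss_word_on \<A> w \<longleftrightarrow> finite \<A> \<and> set w \<subseteq> \<A> \<and> (\<forall>a\<in>\<A>. count_list w a = 2)"

definition gauss_word :: "'a list \<Rightarrow> bool" where
  "gauss_word w \<longleftrightarrow> (\<exists>\<A>. gauss_word_on \<A> w)"

definition isomorphic_words :: "'a list \<Rightarrow> 'b list \<Rightarrow> bool" where
  "isomorphic_words u v \<longleftrightarrow>
     (\<exists>\<A> \<B> f. gauss_word_on \<A> u \<and> gauss_word_on \<B> v \<and> bij_betw f \<A> \<B> \<and> v = map f u)"

text \<open>The moves are given in one direction only and on arbitrary words; both directions, and the
  condition that both sides are Gauss words, enter in the homotopy steps below.\<close>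

inductive homotopy_move :: "'a list \<Rightarrow> 'a list \<Rightarrow> bool" where
  Shift: "homotopy_move ([A] @ x @ [A] @ y) (x @ [A] @ y @ [A])"
| H1: "homotopy_move (x @ [A, A] @ y) (x @ y)"
| H2: "A \<noteq> B \<Longrightarrow> homotopy_move (x @ [A, B] @ y @ [B, A] @ z) (x @ y @ z)"
| H3: "A \<noteq> B \<Longrightarrow> A \<noteq> C \<Longrightarrow> B \<noteq> C \<Longrightarrow>
    homotopy_move (x @ [A, B] @ y @ [A, C] @ z @ [B, C] @ t)
                  (x @ [B, A] @ y @ [C, A] @ z @ [C, B] @ t)"

definition homotopy_step :: "'a list \<Rightarrow> 'a list \<Rightarrow> bool" where
  "homotopy_step u v \<longleftrightarrow> gauss_word u \<and> gauss_word v \<and>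
     (isomorphic_words u v \<or> homotopy_move u v \<or> homotopy_move v u)"

definition homotopy_rel :: "('a list \<times> 'a list) set" where
  "homotopy_rel = {(u, v). gauss_word u \<and> gauss_word v \<and> homotopy_step\<^sup>*\<^sup>* u v}"

text \<open>Alphabets are finite subsets of a letter type. Over an infinite type every Gauss word has an
  isomorphic copy and fresh letters are always available, so no homotopy class is lost.\<close>

definition homotopy_classes :: "'a list set set" where
  "homotopy_classes = {w. gauss_word w} // homotopy_rel"

lemma gauss_word_on_set: "gauss_word_on \<A> w \<Longrightarrow> set w = \<A>"
proof -
  assume *: "gauss_word_on \<A> w"
  have "a \<in> set w" if "a \<in> \<A>" for a
    using * that count_list_0_iff[of w a] unfolding gauss_word_on_def by (metis zero_neq_numeral)
  with * show ?thesis unfolding gauss_word_on_def by blast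
qed

lemma isomorphic_words_sym: "isomorphic_words u v \<Longrightarrow> isomorphic_words v u"
proof -
  assume "isomorphic_words u v"
  then obtain \<A> \<B> f where *: "gauss_word_on \<A> u" "gauss_word_on \<B> v" "bij_betw f \<A> \<B>" "v = map f u"
    unfolding isomorphic_words_def by blast
  have "inj_on f (set u)"
    using * gauss_word_on_set[OF *(1)] by (simp add: bij_betw_def)
  then have "map (inv_into \<A> f) v = map (\<lambda>x. x) u"
    unfolding *(4) map_map gauss_word_on_set[OF *(1), symmetric] by (intro map_cong) simp_all
  then have "u = map (inv_into \<A> f) v"
    by simp
  then show ?thesis
    unfolding isomorphic_words_def
    by (intro exI conjI) (rule *(2), rule *(1), rule bij_betw_inv_into[OF *(3)])
qed

lemma homotopy_step_sym: "homotopy_step u v \<Longrightarrow> homotopy_step v u"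
  unfolding homotopy_step_def using isomorphic_words_sym[of u v] by blast

lemma equiv_homotopy_rel: "equiv {w :: 'a list. gauss_word w} homotopy_rel"
proof (rule equivI)
  have "symp (homotopy_step :: 'a list \<Rightarrow> 'a list \<Rightarrow> bool)"
    by (rule sympI) (rule homotopy_step_sym)
  then have "symp (homotopy_step\<^sup>*\<^sup>* :: 'a list \<Rightarrow> 'a list \<Rightarrow> bool)"
    by (rule symp_rtranclp)
  then show "sym (homotopy_rel :: ('a list \<times> 'a list) set)"
    by (simp add: sym_def symp_def homotopy_rel_def)
  show "trans (homotopy_rel :: ('a list \<times> 'a list) set)"
    by (rule transI) (simp add: homotopy_rel_def, elim conjE, rule rtranclp_trans)
  show "homotopy_rel \<subseteq> {w :: 'a list. gauss_word w} \<times> {w. gauss_word w}"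
    unfolding homotopy_rel_def by blast
  show "refl_on {w :: 'a list. gauss_word w} homotopy_rel"
    unfolding homotopy_rel_def refl_on_def by blast
qed

end

theory Submission imports Defs begin

text \<open>
  The classes are told apart by an integer invariant. Two letters \<open>a\<close>, \<open>b\<close> of a Gauss word are
  interlaced if they alternate, as in \<open>a b a b\<close>. Call a letter even if its two occurrences have
  positions of opposite parity, which amounts to being interlaced with an even number of letters,
  and odd otherwise. Attach to every letter \<open>a\<close> the sign \<open>(-1)^k\<close>, where \<open>k\<close> is the number of even
  letters interlaced with \<open>a\<close>, and let \<open>signed_sum w\<close> be the alternating sum of these signs
  along \<open>w\<close>. Even letters cancel in this sum, odd ones contribute \<open>2\<close> or \<open>-2\<close>.

  The absolute value of the signed sum is a homotopy invariant. The parity of a letter survives all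
  moves. A shift moves every position by one and so changes the sign of the sum. The letters
  removed by H1 or H2 stand in adjacent pairs of equal sign, which cancel; and they leave the other
  signs alone, because the letter of H1 is interlaced with nothing, while the two letters of H2
  have the same parity and are interlaced with the same letters. H3 is the essential case:
  it toggles the interlacing of each pair among \<open>A\<close>, \<open>B\<close>, \<open>C\<close>, and the number of even letters
  among these three is always odd. If all three are even, their signs do not matter. If just one
  is even, then the signs of the two odd ones are reversed; the move also exchanges neighbouring
  positions, which reverses the signs in the alternating sum, and both reversals compensate.

  Reading an even letter as the reflection \<open>x \<mapsto> -x\<close> of the line and an odd letter of sign \<open>c\<close> as
  \<open>x \<mapsto> c - x\<close>, one can view a Gauss word as a product of reflections, an element of the infinite
  dihedral group. This product is a translation, by the signed sum up to a sign, and its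
  conjugacy class is what the absolute value records.

  The word \<open>ABACDBDECE\<close> has signed sum \<open>8\<close>. Since the signed sum is additive for concatenation of
  words without common letters, concatenating \<open>n\<close> disjoint copies gives the value \<open>8n\<close>, and
  different \<open>n\<close> give different classes.
\<close>

section \<open>The signed sum of a Gauss word\<close>

fun alt_sum :: "('a \<Rightarrow> int) \<Rightarrow> 'a list \<Rightarrow> int" where
  "alt_sum f [] = 0"
| "alt_sum f (x # xs) = f x - alt_sum f xs"

text \<open>For a letter that occurs twice the alternating sum vanishes if and only if the two occurrences
  are at positions of opposite parity. In this form the moves act on parity and on the signed sum
  by the same rules for \<^const>\<open>alt_sum\<close>.\<close>

definition even_letter :: "'a list \<Rightarrow> 'a \<Rightarrow> bool" where
  "even_letter w a \<longleftrightarrow> alt_sum (\<lambda>x. of_bool (x = a)) w = 0"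

definition interlaced :: "'a list \<Rightarrow> 'a \<Rightarrow> 'a \<Rightarrow> bool" where
  "interlaced w a b \<longleftrightarrow>
     a \<noteq> b \<and> filter (\<lambda>x. x = a \<or> x = b) w \<in> {[a, b, a, b], [b, a, b, a]}"

definition letter_sign :: "'a list \<Rightarrow> 'a \<Rightarrow> int" where
  "letter_sign w a = (\<Prod>b\<in>set w. if interlaced w a b \<and> even_letter w b then - 1 else 1)"

text \<open>The sum runs over all letters: in a Gauss word the two occurrences of an even letter cancel,
  so only odd letters contribute.\<close>

definition signed_sum :: "'a list \<Rightarrow> int" where
  "signed_sum w = alt_sum (letter_sign w) w"

lemma alt_sum_append: "alt_sum f (u @ v) = alt_sum f u + (- 1) ^ length u * alt_sum f v"
  by (induction u) (auto simp: algebra_simps)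

lemma alt_sum_map: "alt_sum f (map g u) = alt_sum (f \<circ> g) u"
  by (induction u) auto

lemma alt_sum_cong: "(\<And>a. a \<in> set u \<Longrightarrow> f a = g a) \<Longrightarrow> alt_sum f u = alt_sum g u"
  by (induction u) auto

lemma alt_sum_zero: "(\<And>a. a \<in> set u \<Longrightarrow> f a = 0) \<Longrightarrow> alt_sum f u = 0"
  by (induction u) auto

lemma alt_sum_of_bool_notin: "a \<notin> set u \<Longrightarrow> alt_sum (\<lambda>x. of_bool (x = a)) u = 0"
  by (rule alt_sum_zero) auto

lemma interlaced_irrefl: "\<not> interlaced w a a"
  by (simp add: interlaced_def)

lemma interlaced_sym: "interlaced w a b \<longleftrightarrow> interlaced w b a"
proof -
  have "(\<lambda>x. x = a \<or> x = b) = (\<lambda>x. x = b \<or> x = a)"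
    by auto
  then show ?thesis
    by (auto simp: interlaced_def)
qed

lemma letter_sign_cong:
  assumes "set v = set u"
    and "\<And>b. b \<in> set u \<Longrightarrow>
           (interlaced v a b \<and> even_letter v b) \<longleftrightarrow> (interlaced u a b \<and> even_letter u b)"
  shows "letter_sign v a = letter_sign u a"
  unfolding letter_sign_def using assms by (intro prod.cong) auto

lemma gauss_word_count: "gauss_word w \<Longrightarrow> a \<in> set w \<Longrightarrow> count_list w a = 2"
  unfolding gauss_word_def gauss_word_on_def by blast

lemma gauss_wordI: "(\<And>a. a \<in> set w \<Longrightarrow> count_list w a = 2) \<Longrightarrow> gauss_word w"
  unfolding gauss_word_def gauss_word_on_def by (rule exI[of _ "set w"]) auto

text \<open>Evenness of the length makes a shift reverse the sign of every alternating sum, and makes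
  alternating sums additive for concatenation.\<close>

lemma even_length_gauss_word:
  assumes "gauss_word w"
  shows "even (length w)"
proof -
  have "length w = (\<Sum>a\<in>set w. count_list w a)"
    by (simp add: sum_count_set)
  also have "\<dots> = (\<Sum>a\<in>set w. 2)"
    using gauss_word_count[OF assms] by (intro sum.cong) auto
  finally show ?thesis
    by simp
qed

section \<open>Invariance under isomorphisms and homotopy moves\<close>

lemma signed_sum_map:
  assumes "inj_on f (set u)"
  shows "signed_sum (map f u) = signed_sum u"
proof -
  have even: "even_letter (map f u) (f a) \<longleftrightarrow> even_letter u a" if "a \<in> set u" for a
    unfolding even_letter_def alt_sum_map
    using assms that by (intro arg_cong[where f = "\<lambda>s. s = 0"] alt_sum_cong)
      (auto simp: inj_on_eq_iff)
  have inter: "interlaced (map f u) (f a) (f b) \<longleftrightarrow> interlaced u a b"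
    if a: "a \<in> set u" and b: "b \<in> set u" for a b
  proof -
    let ?F = "filter (\<lambda>x. x = a \<or> x = b) u"
    have eq: "filter (\<lambda>x. x = f a \<or> x = f b) (map f u) = map f ?F"
      unfolding filter_map comp_def using assms a b
      by (intro arg_cong[where f = "map f"] filter_cong) (auto simp: inj_on_eq_iff)
    have inj: "map f ?F = map f xs \<longleftrightarrow> ?F = xs" if "set xs \<subseteq> set u" for xs
      by (rule inj_on_map_eq_map, rule inj_on_subset[OF assms]) (use that in auto)
    show ?thesis
      unfolding interlaced_def eq using a b inj[of "[a, b, a, b]"] inj[of "[b, a, b, a]"]
        inj_on_eq_iff[OF assms a b] by auto
  qed
  have sign: "letter_sign (map f u) (f a) = letter_sign u a" if "a \<in> set u" for a
    unfolding letter_sign_def set_map prod.reindex[OF assms]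
    using that even inter by (intro prod.cong) auto
  show ?thesis
    unfolding signed_sum_def alt_sum_map using sign by (intro alt_sum_cong) auto
qed

text \<open>The length of \<open>v\<close> is odd, so all occurrences change the parity of their position, including
  that of the moved letter. The patterns \<open>abab\<close> and \<open>baba\<close> are rotations of each other, so
  interlacing does not notice the shift.\<close>

lemma signed_sum_Shift:
  assumes "gauss_word (A # v)"
  shows "signed_sum (v @ [A]) = - signed_sum (A # v)"
proof -
  have odd: "odd (length v)"
    using even_length_gauss_word[OF assms] by simp
  have rot: "alt_sum f (v @ [A]) = - alt_sum f (A # v)" for f
    using odd by (simp add: alt_sum_append)
  have even: "even_letter (v @ [A]) b \<longleftrightarrow> even_letter (A # v) b" for b
    unfolding even_letter_def rot by simp
  have inter: "interlaced (v @ [A]) a b \<longleftrightarrow> interlaced (A # v) a b" for a b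
  proof -
    have "xs @ [c] = [d, c, d, c] \<longleftrightarrow> xs = [d, c, d]" "xs @ [c] = [c, d, c, d] \<longleftrightarrow> c = d \<and> xs = [c, c, c]"
      for xs and c d :: 'a
      by (auto simp: append_eq_Cons_conv)
    then show ?thesis
      unfolding interlaced_def by auto
  qed
  have "letter_sign (v @ [A]) = letter_sign (A # v)"
    by (intro ext letter_sign_cong) (simp_all add: even inter)
  then show ?thesis
    unfolding signed_sum_def by (simp add: rot)
qed

text \<open>Adjacent occurrences cancel in every alternating sum, and a letter whose occurrences are
  adjacent is interlaced with nothing.\<close>

lemma signed_sum_H1:
  assumes "gauss_word (x @ [A, A] @ y)"
  shows "signed_sum (x @ [A, A] @ y) = signed_sum (x @ y)"
proof -
  let ?w = "x @ [A, A] @ y" and ?v = "x @ y"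
  have A: "A \<notin> set x" "A \<notin> set y"
    using gauss_word_count[OF assms, of A] by (auto simp: count_list_0_iff)
  have cancel: "alt_sum f ?w = alt_sum f ?v" for f
    by (simp add: alt_sum_append)
  have even: "even_letter ?w b \<longleftrightarrow> even_letter ?v b" for b
    unfolding even_letter_def cancel ..
  have inter: "interlaced ?w a b \<longleftrightarrow> interlaced ?v a b" if "a \<noteq> A" "b \<in> set ?v" for a b
  proof -
    have "b \<noteq> A"
      using that A by auto
    then show ?thesis
      using that by (auto simp: interlaced_def)
  qed
  have isolated: "\<not> interlaced ?w a A" for a
    unfolding interlaced_def by (auto simp: append_eq_Cons_conv)
  have sign: "letter_sign ?w a = letter_sign ?v a" if "a \<noteq> A" for a
  proof -
    have "set ?w = insert A (set ?v)"
      by auto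
    then have "letter_sign ?w a =
        (\<Prod>b\<in>set ?v. if interlaced ?w a b \<and> even_letter ?w b then - 1 else 1)"
      unfolding letter_sign_def using A isolated by simp
    also have "\<dots> = letter_sign ?v a"
      unfolding letter_sign_def even using inter[OF that] by (intro prod.cong) simp_all
    finally show ?thesis .
  qed
  have "signed_sum ?w = alt_sum (letter_sign ?w) ?v"
    unfolding signed_sum_def by (rule cancel)
  also have "\<dots> = signed_sum ?v"
    unfolding signed_sum_def using A by (intro alt_sum_cong sign) auto
  finally show ?thesis .
qed

text \<open>The letters \<open>A\<close> and \<open>B\<close> are not interlaced with each other, and renaming \<open>A\<close> into \<open>B\<close> shows that
  they are interlaced with the same other letters. As they also have the same parity, they change
  any other sign both or not at all, and their own signs agree and cancel.\<close>

lemma signed_sum_H2: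
  assumes "A \<noteq> B" and "gauss_word (x @ [A, B] @ y @ [B, A] @ z)"
  shows "signed_sum (x @ [A, B] @ y @ [B, A] @ z) = signed_sum (x @ y @ z)"
proof -
  let ?w = "x @ [A, B] @ y @ [B, A] @ z" and ?v = "x @ y @ z"
  have AB: "A \<notin> set x" "A \<notin> set y" "A \<notin> set z" "B \<notin> set x" "B \<notin> set y" "B \<notin> set z"
    using gauss_word_count[OF assms(2), of A] gauss_word_count[OF assms(2), of B] assms(1)
    by (auto simp: count_list_0_iff)
  \<comment> \<open>The pairs \<open>A B\<close> and \<open>B A\<close> cancel separately, whatever the length of \<open>y\<close>.\<close>
  have cancel: "alt_sum f ?w = alt_sum f ?v" if "f A = f B" for f
    using that by (simp add: alt_sum_append)
  have even: "even_letter ?w b \<longleftrightarrow> even_letter ?v b" if "b \<in> set ?v" for b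
    unfolding even_letter_def using that AB by (subst cancel) auto
  have even_AB: "even_letter ?w A \<longleftrightarrow> even_letter ?w B"
    unfolding even_letter_def using AB assms(1)
    by (simp add: alt_sum_append alt_sum_of_bool_notin algebra_simps)
  have inter: "interlaced ?w a b \<longleftrightarrow> interlaced ?v a b"
    if "a \<noteq> A" "a \<noteq> B" "b \<in> set ?v" for a b
  proof -
    have "b \<noteq> A" "b \<noteq> B"
      using that AB by auto
    then show ?thesis
      using that by (auto simp: interlaced_def)
  qed
  have not_inter: "\<not> interlaced ?w A B"
    using AB assms(1) by (auto simp: interlaced_def filter_empty_conv append_eq_Cons_conv)
  have inter_AB: "interlaced ?w a A \<longleftrightarrow> interlaced ?w a B" if "a \<noteq> A" "a \<noteq> B" for a
  proof -
    let ?h = "\<lambda>c. if c = A then B else c" and ?F = "filter (\<lambda>c. c = a \<or> c = A) ?w"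
    have rename: "map ?h (filter (\<lambda>c. c = a \<or> c = A) u) = filter (\<lambda>c. c = a \<or> c = B) u"
      if "A \<notin> set u" "B \<notin> set u" for u
      using that by (induction u) auto
    have eq: "filter (\<lambda>c. c = a \<or> c = B) ?w = map ?h ?F"
      using AB that assms(1) by (simp add: rename)
    have inj: "map ?h ?F = map ?h xs \<longleftrightarrow> ?F = xs" if "set xs \<subseteq> {a, A}" for xs
      by (rule inj_on_map_eq_map, rule inj_on_subset[of _ "{a, A}"])
        (use that \<open>a \<noteq> B\<close> in \<open>auto simp: inj_on_def\<close>)
    have "map ?h ?F = [a, B, a, B] \<longleftrightarrow> ?F = [a, A, a, A]"
        "map ?h ?F = [B, a, B, a] \<longleftrightarrow> ?F = [A, a, A, a]"
      using inj[of "[a, A, a, A]"] inj[of "[A, a, A, a]"] that by simp_all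
    then show ?thesis
      unfolding interlaced_def eq using that by simp
  qed
  have sign: "letter_sign ?w a = letter_sign ?v a" if "a \<noteq> A" "a \<noteq> B" for a
  proof -
    have "set ?w = insert A (insert B (set ?v))"
      by auto
    then have "letter_sign ?w a =
        (\<Prod>b\<in>set ?v. if interlaced ?w a b \<and> even_letter ?w b then - 1 else 1)"
      unfolding letter_sign_def using AB assms(1) inter_AB[OF that] even_AB by simp
    also have "\<dots> = letter_sign ?v a"
      unfolding letter_sign_def using inter[OF that] even by (intro prod.cong) simp_all
    finally show ?thesis .
  qed
  have "interlaced ?w A c \<longleftrightarrow> interlaced ?w B c" for c
    using inter_AB[of c] not_inter interlaced_irrefl interlaced_sym by metis
  then have "letter_sign ?w A = letter_sign ?w B"
    unfolding letter_sign_def by simp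
  then have "signed_sum ?w = alt_sum (letter_sign ?w) ?v"
    unfolding signed_sum_def by (rule cancel)
  also have "\<dots> = signed_sum ?v"
    unfolding signed_sum_def using AB by (intro alt_sum_cong sign) auto
  finally show ?thesis .
qed

text \<open>With \<open>p = (-1)^|y|\<close> and \<open>q = (-1)^|z|\<close>, the letters \<open>A\<close>, \<open>B\<close>, \<open>C\<close> are even exactly if \<open>p = -1\<close>,
  \<open>p q = 1\<close> and \<open>q = -1\<close>. Hence either all three are even or exactly one is. In the latter case each
  of the two odd letters gains or loses one interlaced even letter, so its sign is reversed.
  That compensates for the exchange of adjacent positions.\<close>

lemma signed_sum_H3:
  assumes distinct: "A \<noteq> B" "A \<noteq> C" "B \<noteq> C"
    and gauss: "gauss_word (x @ [A, B] @ y @ [A, C] @ z @ [B, C] @ t)"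
  shows "signed_sum (x @ [B, A] @ y @ [C, A] @ z @ [C, B] @ t) =
    signed_sum (x @ [A, B] @ y @ [A, C] @ z @ [B, C] @ t)"
proof -
  let ?w = "x @ [A, B] @ y @ [A, C] @ z @ [B, C] @ t"
    and ?v = "x @ [B, A] @ y @ [C, A] @ z @ [C, B] @ t"
  let ?T = "{A, B, C}"
  have notin: "a \<notin> set x" "a \<notin> set y" "a \<notin> set z" "a \<notin> set t" if "a \<in> ?T" for a
    using gauss_word_count[OF gauss, of a] distinct that by (auto simp: count_list_0_iff)
  have set_eq: "set ?v = set ?w"
    by auto
  define p q :: int where "p = (- 1) ^ length y" and "q = (- 1) ^ length z"
  have pq: "p = 1 \<or> p = - 1" "q = 1 \<or> q = - 1"
    unfolding p_def q_def by (simp_all add: minus_one_power_iff)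
  have inter_T: "interlaced ?v a b \<longleftrightarrow> \<not> interlaced ?w a b" if "a \<in> ?T" "b \<in> ?T" "a \<noteq> b" for a b
  proof -
    have empty: "filter (\<lambda>c. c = a \<or> c = b) u = []"
      if "u \<in> {x, y, z, t}" "a \<in> ?T" "b \<in> ?T" for u a b
      using that notin by (auto simp: filter_empty_conv)
    have "interlaced ?v A B \<longleftrightarrow> \<not> interlaced ?w A B"
        "interlaced ?v A C \<longleftrightarrow> \<not> interlaced ?w A C"
        "interlaced ?v B C \<longleftrightarrow> \<not> interlaced ?w B C"
      using distinct by (auto simp: interlaced_def empty)
    with that show ?thesis
      using interlaced_sym[of ?v] interlaced_sym[of ?w] by auto
  qed
  have inter: "interlaced ?v a b \<longleftrightarrow> interlaced ?w a b" if "a \<notin> ?T \<or> b \<notin> ?T" for a b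
  proof -
    have "filter (\<lambda>c. c = a \<or> c = b) ?v = filter (\<lambda>c. c = a \<or> c = b) ?w"
      using that distinct by auto
    then show ?thesis
      by (simp add: interlaced_def)
  qed
  have even_T: "even_letter ?w A \<longleftrightarrow> p = - 1" "even_letter ?w B \<longleftrightarrow> p * q = 1"
      "even_letter ?w C \<longleftrightarrow> q = - 1" "even_letter ?v A \<longleftrightarrow> p = - 1"
      "even_letter ?v B \<longleftrightarrow> p * q = 1" "even_letter ?v C \<longleftrightarrow> q = - 1"
    using distinct pq
    by (auto simp: even_letter_def alt_sum_append alt_sum_of_bool_notin notin
        simp flip: p_def q_def)
  have even: "even_letter ?v a \<longleftrightarrow> even_letter ?w a" for a
  proof (cases "a \<in> ?T")
    case True
    then show ?thesis using even_T by auto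
  next
    case False
    then show ?thesis
      by (auto simp: even_letter_def alt_sum_append algebra_simps)
  qed
  have sign: "letter_sign ?v a = letter_sign ?w a" if "a \<notin> ?T" for a
    by (rule letter_sign_cong[OF set_eq]) (use that inter even in auto)
  \<comment> \<open>Of the two interlacings of \<open>a\<close> that the move toggles, only the one with the even letter \<open>b\<close>
    enters the sign of \<open>a\<close>.\<close>
  have flip: "letter_sign ?v a = - letter_sign ?w a"
    if T: "{a, b, c} = ?T" and "a \<noteq> b" "b \<noteq> c" "a \<noteq> c"
      and b: "even_letter ?w b" and c: "\<not> even_letter ?w c" for a b c
  proof -
    let ?g = "\<lambda>u d. if interlaced u a d \<and> even_letter u d then - 1 else 1 :: int"
    have ab: "a \<in> ?T" "b \<in> ?T"
      using T by auto
    have "b \<in> set ?w"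
      using ab(2) by auto
    then have split: "letter_sign u a = ?g u b * (\<Prod>d\<in>set ?w - {b}. ?g u d)"
      if "set u = set ?w" for u
      unfolding letter_sign_def that by (intro prod.remove) auto
    have "?g ?v d = ?g ?w d" if "d \<noteq> b" for d
    proof (cases "d \<in> ?T")
      case True
      then have "d = a \<or> d = c"
        using T \<open>d \<noteq> b\<close> by auto
      then show ?thesis
        using c even interlaced_irrefl by metis
    next
      case False
      then show ?thesis
        using inter even by simp
    qed
    then have "(\<Prod>d\<in>set ?w - {b}. ?g ?v d) = (\<Prod>d\<in>set ?w - {b}. ?g ?w d)"
      by (intro prod.cong) auto
    moreover have "?g ?v b = - ?g ?w b"
      using inter_T[OF ab \<open>a \<noteq> b\<close>] even b by simp
    ultimately show ?thesis
      unfolding split[OF set_eq] split[OF refl] by simp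
  qed
  let ?s = "letter_sign ?w" and ?r = "letter_sign ?v"
  have rest: "alt_sum ?r u = alt_sum ?s u" if "u \<in> {x, y, z, t}" for u
    using that notin by (intro alt_sum_cong sign) blast
  \<comment> \<open>Collecting the two occurrences of each letter gives even letters the coefficient \<open>0\<close>, so that
    only the reversed signs of the odd ones enter.\<close>
  have "?s A * (1 + p) - ?s B * (1 - p * q) - ?s C * p * (1 + q) =
      - (?r A * (1 + p) - ?r B * (1 - p * q) - ?r C * p * (1 + q))"
  proof -
    consider "p = 1" "q = 1" | "p = 1" "q = - 1" | "p = - 1" "q = 1" | "p = - 1" "q = - 1"
      using pq by blast
    then show ?thesis
    proof cases
      case 1
      then have "?r A = - ?s A" "?r C = - ?s C"
        using even_T distinct by (intro flip[of A B C] flip[of C B A]; auto)+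
      then show ?thesis using 1 by simp
    next
      case 2
      then have "?r A = - ?s A" "?r B = - ?s B"
        using even_T distinct by (intro flip[of A C B] flip[of B C A]; auto)+
      then show ?thesis using 2 by simp
    next
      case 3
      then have "?r B = - ?s B" "?r C = - ?s C"
        using even_T distinct by (intro flip[of B A C] flip[of C A B]; auto)+
      then show ?thesis using 3 by simp
    next
      case 4
      then show ?thesis by simp
    qed
  qed
  then have "?s A - ?s B + p * (?s A - ?s C) + p * q * (?s B - ?s C) =
      ?r B - ?r A + p * (?r C - ?r A) + p * q * (?r C - ?r B)"
    by (simp add: algebra_simps)
  moreover have "signed_sum ?w = alt_sum ?s x + (- 1) ^ length x *
      (?s A - ?s B + p * (?s A - ?s C) + p * q * (?s B - ?s C) +
       alt_sum ?s y + p * alt_sum ?s z + p * q * alt_sum ?s t)"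
    unfolding signed_sum_def alt_sum_append by (simp add: p_def q_def algebra_simps)
  moreover have "signed_sum ?v = alt_sum ?r x + (- 1) ^ length x *
      (?r B - ?r A + p * (?r C - ?r A) + p * q * (?r C - ?r B) +
       alt_sum ?r y + p * alt_sum ?r z + p * q * alt_sum ?r t)"
    unfolding signed_sum_def alt_sum_append by (simp add: p_def q_def algebra_simps)
  ultimately show ?thesis
    using rest by simp
qed

lemma abs_signed_sum_move:
  assumes "homotopy_move u v" and "gauss_word u"
  shows "\<bar>signed_sum v\<bar> = \<bar>signed_sum u\<bar>"
  using assms
proof cases
  case (Shift A x y)
  then show ?thesis
    using signed_sum_Shift[of A "x @ [A] @ y"] assms(2) by simp
next
  case (H1 x A y)
  then show ?thesis
    using signed_sum_H1 assms(2) by metis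
next
  case (H2 A B x y z)
  then show ?thesis
    using signed_sum_H2 assms(2) by metis
next
  case (H3 A B C x y z t)
  then show ?thesis
    using signed_sum_H3 assms(2) by metis
qed

lemma abs_signed_sum_step:
  assumes "homotopy_step u v"
  shows "\<bar>signed_sum v\<bar> = \<bar>signed_sum u\<bar>"
proof -
  have "signed_sum v = signed_sum u" if "isomorphic_words u v"
  proof -
    from that obtain \<A> \<B> f where "gauss_word_on \<A> u" "bij_betw f \<A> \<B>" "v = map f u"
      unfolding isomorphic_words_def by blast
    then show ?thesis
      using signed_sum_map gauss_word_on_set bij_betw_imp_inj_on by metis
  qed
  with assms show ?thesis
    unfolding homotopy_step_def using abs_signed_sum_move by metis
qed

lemma abs_signed_sum_homotopic:
  assumes "(u, v) \<in> homotopy_rel"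
  shows "\<bar>signed_sum v\<bar> = \<bar>signed_sum u\<bar>"
proof -
  have "homotopy_step\<^sup>*\<^sup>* u v"
    using assms by (simp add: homotopy_rel_def)
  then show ?thesis
    by induction (simp_all add: abs_signed_sum_step)
qed

section \<open>Words with arbitrarily large signed sum\<close>

lemma filter_eq_replicate_count_list: "filter (\<lambda>x. x = a) w = replicate (count_list w a) a"
  by (induction w) auto

lemma gauss_word_append:
  assumes "gauss_word u" "gauss_word v" "set u \<inter> set v = {}"
  shows "gauss_word (u @ v)"
proof (rule gauss_wordI)
  fix a assume "a \<in> set (u @ v)"
  then show "count_list (u @ v) a = 2"
    using gauss_word_count[OF assms(1), of a] gauss_word_count[OF assms(2), of a] assms(3)
      count_list_0_iff[of u a] count_list_0_iff[of v a] by auto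
qed

text \<open>Letters of different factors are not interlaced, so they do not influence each other's signs,
  and the even length of \<open>u\<close> preserves the parity of the positions in \<open>v\<close>.\<close>

lemma signed_sum_append:
  assumes u: "gauss_word u" and v: "gauss_word v" and disj: "set u \<inter> set v = {}"
  shows "signed_sum (u @ v) = signed_sum u + signed_sum v"
proof -
  let ?w = "u @ v"
  have split: "alt_sum f ?w = alt_sum f u + alt_sum f v" for f
    using even_length_gauss_word[OF u] by (simp add: alt_sum_append)
  have even_u: "even_letter ?w a \<longleftrightarrow> even_letter u a" if "a \<in> set u" for a
    unfolding even_letter_def split using that disj by (subst (2) alt_sum_of_bool_notin) auto
  have even_v: "even_letter ?w a \<longleftrightarrow> even_letter v a" if "a \<in> set v" for a
    unfolding even_letter_def split using that disj by (subst alt_sum_of_bool_notin) auto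
  have inter_u: "interlaced ?w a b \<longleftrightarrow> interlaced u a b" if "a \<in> set u" "b \<in> set u" for a b
  proof -
    have "filter (\<lambda>x. x = a \<or> x = b) v = []"
      using that disj by (auto simp: filter_empty_conv)
    then show ?thesis by (simp add: interlaced_def)
  qed
  have inter_v: "interlaced ?w a b \<longleftrightarrow> interlaced v a b" if "a \<in> set v" "b \<in> set v" for a b
  proof -
    have "filter (\<lambda>x. x = a \<or> x = b) u = []"
      using that disj by (auto simp: filter_empty_conv)
    then show ?thesis by (simp add: interlaced_def)
  qed
  have inter_uv: "\<not> interlaced ?w a b" if "a \<in> set u" "b \<in> set v" for a b
  proof -
    have "filter (\<lambda>x. x = a \<or> x = b) u = filter (\<lambda>x. x = a) u"
      "filter (\<lambda>x. x = a \<or> x = b) v = filter (\<lambda>x. x = b) v"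
      using that disj by (auto intro!: filter_cong)
    then have "filter (\<lambda>x. x = a \<or> x = b) ?w = [a, a, b, b]"
      using that gauss_word_count[OF u] gauss_word_count[OF v]
      by (simp add: filter_eq_replicate_count_list numeral_2_eq_2)
    then show ?thesis by (auto simp: interlaced_def)
  qed
  have union: "letter_sign ?w a =
      (\<Prod>b\<in>set u. if interlaced ?w a b \<and> even_letter ?w b then - 1 else 1) *
      (\<Prod>b\<in>set v. if interlaced ?w a b \<and> even_letter ?w b then - 1 else 1)" for a
    unfolding letter_sign_def set_append using disj by (intro prod.union_disjoint) auto
  have "letter_sign ?w a = letter_sign u a" if "a \<in> set u" for a
  proof -
    have "(\<Prod>b\<in>set v. if interlaced ?w a b \<and> even_letter ?w b then - 1 else 1) = (1 :: int)"
      using that inter_uv by (intro prod.neutral) auto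
    then show ?thesis
      unfolding union unfolding letter_sign_def using that even_u inter_u by simp
  qed
  moreover have "letter_sign ?w a = letter_sign v a" if "a \<in> set v" for a
  proof -
    have "(\<Prod>b\<in>set u. if interlaced ?w a b \<and> even_letter ?w b then - 1 else 1) = (1 :: int)"
      using that inter_uv interlaced_sym[of ?w a] by (intro prod.neutral) auto
    then show ?thesis
      unfolding union unfolding letter_sign_def using that even_v inter_v by simp
  qed
  ultimately show ?thesis
    unfolding signed_sum_def split by (intro arg_cong2[where f = "(+)"] alt_sum_cong) auto
qed

lemma gauss_word_map:
  assumes "inj_on f (set u)" "gauss_word u"
  shows "gauss_word (map f u)"
proof (rule gauss_wordI)
  fix b assume "b \<in> set (map f u)"
  then obtain a where a: "a \<in> set u" "b = f a"
    by auto
  have "filter (\<lambda>x. x = b) (map f u) = map f (filter (\<lambda>x. x = a) u)"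
    unfolding filter_map comp_def using assms(1) a
    by (intro arg_cong[where f = "map f"] filter_cong) (auto simp: inj_on_eq_iff)
  then have "count_list (map f u) b = count_list u a"
    unfolding filter_eq_replicate_count_list by (metis length_map length_replicate)
  then show "count_list (map f u) b = 2"
    using gauss_word_count[OF assms(2) a(1)] by simp
qed

text \<open>The word \<open>ABACDBDECE\<close>, with the letters \<open>A\<close> to \<open>E\<close> numbered from \<open>0\<close>. Its only even letter is \<open>2\<close>,
  which is interlaced with \<open>1\<close> and \<open>4\<close>. So the odd letters \<open>0\<close> and \<open>3\<close>, at even positions counted
  from \<open>0\<close>, have sign \<open>1\<close>, while the odd letters \<open>1\<close> and \<open>4\<close>, at odd positions, have sign \<open>-1\<close>:
  all eight occurrences contribute \<open>1\<close>.\<close>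

definition seed_word :: "nat list" where
  "seed_word = [0, 1, 0, 2, 3, 1, 3, 4, 2, 4]"

lemma gauss_word_seed_word: "gauss_word seed_word"
  by (rule gauss_wordI) (auto simp: seed_word_def)

lemma signed_sum_seed_word: "signed_sum seed_word = 8"
proof -
  have set: "set seed_word = {0, 1, 2, 3, 4}"
    by (auto simp: seed_word_def)
  have even: "even_letter seed_word b \<longleftrightarrow> b = 2" if "b \<in> set seed_word" for b
    using that unfolding set by (auto simp: even_letter_def seed_word_def)
  have "letter_sign seed_word a = (\<Prod>b\<in>set seed_word.
      if b = 2 then if interlaced seed_word a 2 then - 1 else 1 else 1)" for a
    unfolding letter_sign_def using even by (intro prod.cong) auto
  then have sign: "letter_sign seed_word a = (if interlaced seed_word a 2 then - 1 else 1)" for a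
    by (simp add: set)
  show ?thesis
    unfolding signed_sum_def sign by (simp add: interlaced_def seed_word_def)
qed

text \<open>An infinite letter type always has room for another copy of the seed word whose letters are
  new.\<close>

lemma ex_gauss_word_signed_sum:
  assumes "infinite (UNIV :: 'a set)"
  shows "\<exists>w :: 'a list. gauss_word w \<and> signed_sum w = 8 * int n"
proof (induction n)
  case 0
  have "gauss_word ([] :: 'a list)"
    by (rule gauss_wordI) simp
  then show ?case
    by (intro exI[of _ "[]"]) (simp add: signed_sum_def)
next
  case (Suc n)
  then obtain w :: "'a list" where w: "gauss_word w" "signed_sum w = 8 * int n"
    by blast
  have "infinite (- set w)"
    using assms by (simp add: Compl_eq_Diff_UNIV)
  then obtain f :: "nat \<Rightarrow> 'a" where f: "inj f" "range f \<subseteq> - set w"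
    using infinite_countable_subset by blast
  have inj: "inj_on f (set seed_word)"
    using f(1) by (rule inj_on_subset) simp
  have disj: "set w \<inter> set (map f seed_word) = {}"
    using f(2) by auto
  have "gauss_word (w @ map f seed_word)"
    using w(1) gauss_word_map[OF inj gauss_word_seed_word] disj by (rule gauss_word_append)
  moreover have "signed_sum (w @ map f seed_word) = 8 * int (Suc n)"
    using signed_sum_append[OF w(1) gauss_word_map[OF inj gauss_word_seed_word] disj]
    by (simp add: w(2) signed_sum_map[OF inj] signed_sum_seed_word)
  ultimately show ?case
    by blast
qed

theorem proposition5p9:
  assumes "infinite (UNIV :: 'a set)"
  shows "infinite (homotopy_classes :: 'a list set set)"
proof -
  obtain W :: "nat \<Rightarrow> 'a list" where W: "\<And>n. gauss_word (W n)" "\<And>n. signed_sum (W n) = 8 * int n"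
    using ex_gauss_word_signed_sum[OF assms] by metis
  let ?class = "\<lambda>n. homotopy_rel `` {W n}"
  have "inj ?class"
  proof (rule injI)
    fix m n assume "?class m = ?class n"
    then have "(W m, W n) \<in> homotopy_rel"
      using W(1) by (intro eq_equiv_class[OF _ equiv_homotopy_rel]) auto
    then show "m = n"
      using abs_signed_sum_homotopic[of "W m" "W n"] by (simp add: W(2))
  qed
  then have "infinite (range ?class)"
    using finite_imageD by blast
  moreover have "range ?class \<subseteq> homotopy_classes"
    unfolding homotopy_classes_def using W(1) by (auto intro!: quotientI)
  ultimately show ?thesis
    by (rule infinite_super[rotated])
qed

end
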